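(* Assume $\diamondsuit$. Then for every function $f:\mathbb{N}\to\mathbb{N}$ there is a Hajnal–Máté graph $G$ such that $|G|=\chi(G)=\aleph_1$ and, for every natural number $k\ge 3$, $f_G(k)\ge f(k)$; that is, every subgraph of $G$ with fewer than $f(k)$ vertices has chromatic number less than $k$.
   Context: $\diamondsuit$ is the assertion that there is a sequence $\langle A_\alpha\mid\alpha<\omega_1\rangle$ with $A_\alpha\subseteq\alpha$ for each $\alpha$ such that for every $A\subseteq\omega_1$ the set $\{\alpha<\omega_1\mid A\cap\alpha=A_\alpha\}$ is stationary. A graph $G=(\omega_1,E)$ is a Hajnal–Máté graph if for every $\beta<\omega_1$ the set $\{\alpha<\beta\mid \{\alpha,\beta\}\in E\}$ is either finite or a set of order type $\omega$ converging to $\beta$ (i.e., cofinal in $\beta$). Graphs are simple undirected graphs. For a graph $G$ with infinite chromatic number and $k\in\mathbb{N}$, $f_G(k)$ is the least natural number $m$ such that $G$ has a subgraph with $m$ vertices and chromatic number at least $k$. *)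

theory Defs
  imports "HOL-Library.Countable_Set"
begin

text \<open>omega_1 is represented by a well-ordered type 'a which is uncountable
  but all of whose proper initial segments are countable (i.e. order type omega_1).\<close>

definition is_omega1 :: "'a::wellorder itself \<Rightarrow> bool" where
  "is_omega1 _ \<longleftrightarrow> uncountable (UNIV :: 'a set) \<and> (\<forall>x::'a. countable {y. y < x})"

definition club :: "'a::wellorder set \<Rightarrow> bool" where
  "club C \<longleftrightarrow>
     (\<forall>\<beta>. \<exists>\<gamma>\<in>C. \<beta> < \<gamma>) \<and>
     (\<forall>\<alpha>. (\<exists>\<gamma>\<in>C. \<gamma> < \<alpha>) \<and> (\<forall>\<beta><\<alpha>. \<exists>\<gamma>\<in>C. \<beta> < \<gamma> \<and> \<gamma> < \<alpha>) \<longrightarrow> \<alpha> \<in> C)"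

definition stationary :: "'a::wellorder set \<Rightarrow> bool" where
  "stationary S \<longleftrightarrow> (\<forall>C. club C \<longrightarrow> S \<inter> C \<noteq> {})"

definition diamond :: "'a::wellorder itself \<Rightarrow> bool" where
  "diamond _ \<longleftrightarrow> (\<exists>A :: 'a \<Rightarrow> 'a set.
      (\<forall>\<alpha>. A \<alpha> \<subseteq> {..<\<alpha>}) \<and>
      (\<forall>X :: 'a set. stationary {\<alpha>. X \<inter> {..<\<alpha>} = A \<alpha>}))"

definition simple_graph :: "('a \<Rightarrow> 'a \<Rightarrow> bool) \<Rightarrow> bool" where
  "simple_graph E \<longleftrightarrow> (\<forall>x y. E x y \<longrightarrow> E y x) \<and> (\<forall>x. \<not> E x x)"

definition hajnal_mate :: "('a::wellorder \<Rightarrow> 'a \<Rightarrow> bool) \<Rightarrow> bool" where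
  "hajnal_mate E \<longleftrightarrow> simple_graph E \<and>
     (\<forall>\<beta>. let S = {\<alpha>. \<alpha> < \<beta> \<and> E \<alpha> \<beta>} in
        finite S \<or>
        (infinite S \<and> (\<forall>\<alpha>\<in>S. finite {x\<in>S. x < \<alpha>}) \<and> (\<forall>\<gamma><\<beta>. \<exists>\<alpha>\<in>S. \<gamma> < \<alpha>)))"

definition proper_colouring :: "'a set \<Rightarrow> ('a \<Rightarrow> 'a \<Rightarrow> bool) \<Rightarrow> ('a \<Rightarrow> 'c) \<Rightarrow> bool" where
  "proper_colouring V E c \<longleftrightarrow> (\<forall>x\<in>V. \<forall>y\<in>V. E x y \<longrightarrow> c x \<noteq> c y)"

definition chromatic_number :: "'a set \<Rightarrow> ('a \<Rightarrow> 'a \<Rightarrow> bool) \<Rightarrow> nat" where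
  "chromatic_number V E = (LEAST n. \<exists>c :: 'a \<Rightarrow> nat. c ` V \<subseteq> {..<n} \<and> proper_colouring V E c)"

definition subgraph :: "'a set \<Rightarrow> ('a \<Rightarrow> 'a \<Rightarrow> bool) \<Rightarrow> 'a set \<Rightarrow> ('a \<Rightarrow> 'a \<Rightarrow> bool) \<Rightarrow> bool" where
  "subgraph V' E' V E \<longleftrightarrow> V' \<subseteq> V \<and> simple_graph E' \<and>
     (\<forall>x y. E' x y \<longrightarrow> x \<in> V' \<and> y \<in> V' \<and> E x y)"

end

theory Submission
  imports Defs
begin

text \<open>Diamond guesses at \<open>\<delta>\<close> a colouring \<open>c\<close> together with an unbounded set \<open>D\<close>. The ladder of
  \<open>\<delta>\<close> is an \<open>\<omega>\<close>-sequence \<open>y\<close> in the guessed part of \<open>D\<close>, cofinal in \<open>\<delta>\<close>, and for each \<open>n\<close> the vertex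
  \<open>\<delta>\<close> is joined to at most one \<open>\<alpha> > y n\<close> of guessed colour \<open>n\<close>, whose ladder \<open>x\<close> must satisfy
  \<open>x (2j) < y j < x (2j+1)\<close> for \<open>j < l n\<close>, where \<open>l\<close> grows fast in terms of \<open>f\<close>.

  The edges with index \<open>n\<close> form a forest, so those with index below \<open>n\<close> need only \<open>2^n\<close> colours.
  Those with index at least \<open>n\<close> are bipartite on few vertices: passing along an edge doubles
  or halves the number of ladder points below a fixed ordinal, up to a bounded error.

  Given a colouring \<open>c\<close>, let \<open>D\<close> be the set of ordinals reflecting the trees of initial segments of
  ladders of vertices of each colour. If \<open>\<delta>\<close> guesses \<open>c\<close> and \<open>D\<close> correctly and \<open>c \<delta> = n\<close>, then the ladder
  of \<open>\<delta>\<close> itself shows that the tree of colour \<open>n\<close> is uncountably branching, and reflection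
  produces below \<open>\<delta>\<close> a vertex of colour \<open>n\<close> with an interleaved ladder. Hence \<open>\<delta>\<close> has a neighbour of
  its own colour.\<close>

section \<open>Closure points in omega1\<close>

lemma omega1_countable_bounded:
  fixes A :: "'a::wellorder set"
  assumes "is_omega1 TYPE('a)" "countable A"
  shows "\<exists>b. \<forall>a\<in>A. a < b"
proof (rule ccontr)
  assume "\<not> ?thesis"
  then have "UNIV \<subseteq> (\<Union>a\<in>A. insert a {y. y < a})"
    by (force simp: not_less le_less)
  moreover have "countable (\<Union>a\<in>A. insert a {y. y < a})"
    using assms unfolding is_omega1_def by (intro countable_UN) auto
  ultimately show False
    using assms(1) countable_subset unfolding is_omega1_def by blast
qed

lemma omega1_no_top:
  assumes "is_omega1 TYPE('a::wellorder)"
  shows "\<exists>y. (x::'a) < y"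
  using omega1_countable_bounded[OF assms, of "{x}"] by auto

lemma finite_list_below_member:
  fixes S :: "'a::linorder set"
  assumes "S \<noteq> {}" "\<forall>x\<in>set \<sigma>. \<exists>\<gamma>\<in>S. x < \<gamma>"
  shows "\<exists>\<gamma>\<in>S. \<sigma> \<in> lists {..<\<gamma>}"
  using assms(2)
proof (induction \<sigma>)
  case Nil
  then show ?case using assms(1) by auto
next
  case (Cons x \<sigma>)
  then obtain g h where "g \<in> S" "\<sigma> \<in> lists {..<g}" "h \<in> S" "x < h"
    by auto
  then show ?case
    by (intro bexI[of _ "max g h"]) (auto simp: in_lists_conv_set max_def)
qed

text \<open>Taking lists as arguments lets one operator encode functions of every finite arity; its
  values at \<open>[]\<close> act as constants that lie below every closure point.\<close>

definition closed_under :: "('a::wellorder list \<Rightarrow> 'a set) \<Rightarrow> 'a \<Rightarrow> bool" where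
  "closed_under H \<gamma> \<longleftrightarrow> (\<forall>\<sigma>\<in>lists {..<\<gamma>}. H \<sigma> \<subseteq> {..<\<gamma>})"

text \<open>A finite list below the supremum of an increasing sequence already lies below one of its
  terms. So the supremum of \<omega> many closing-off steps is a closure point, and limits of
  closure points are again closure points.\<close>

lemma club_closed_under:
  fixes H :: "'a::wellorder list \<Rightarrow> 'a set"
  assumes om: "is_omega1 TYPE('a)" and H: "\<And>\<sigma>. countable (H \<sigma>)"
  shows "club {\<gamma>. closed_under H \<gamma>}"
  unfolding club_def
proof (intro conjI allI impI)
  fix \<beta> :: 'a
  have "\<exists>b'. b < b' \<and> (\<forall>\<sigma>\<in>lists {..<b}. H \<sigma> \<subseteq> {..<b'})" for b
  proof -
    have "countable {..<b}"
      using om unfolding is_omega1_def lessThan_def by auto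
    then have "countable (insert b (\<Union>\<sigma>\<in>lists {..<b}. H \<sigma>))"
      using H by (intro countable_insert countable_UN countable_lists)
    from omega1_countable_bounded[OF om this] show ?thesis
      by blast
  qed
  then have "\<exists>b'. \<beta> < b' \<and> b < b' \<and> (\<forall>\<sigma>\<in>lists {..<b}. H \<sigma> \<subseteq> {..<b'})" if "\<beta> < b" for b
    using that less_trans by blast
  then obtain s where s: "\<And>n. \<beta> < s n" "\<And>n. s n < s (Suc n) \<and> (\<forall>\<sigma>\<in>lists {..<s n}. H \<sigma> \<subseteq> {..<s (Suc n)})"
    using dependent_nat_choice[of "\<lambda>_ b. \<beta> < b"
        "\<lambda>_ b b'. b < b' \<and> (\<forall>\<sigma>\<in>lists {..<b}. H \<sigma> \<subseteq> {..<b'})", OF omega1_no_top[OF om]]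
    by blast
  define g where "g = (LEAST g. \<forall>n. s n \<le> g)"
  have "\<exists>g. \<forall>n. s n \<le> g"
    using omega1_countable_bounded[OF om, of "range s"] by (auto intro: less_imp_le)
  then have g: "s n \<le> g" for n
    unfolding g_def by (rule LeastI2_ex) auto
  have below: "\<exists>n. x < s n" if "x < g" for x
    using not_less_Least[OF that[unfolded g_def]] by (auto simp: not_le)
  have "closed_under H g"
    unfolding closed_under_def
  proof
    fix \<sigma> assume "\<sigma> \<in> lists {..<g}"
    then obtain n where "\<sigma> \<in> lists {..<s n}"
      using finite_list_below_member[of "range s" \<sigma>] below by (auto simp: in_lists_conv_set)
    then show "H \<sigma> \<subseteq> {..<g}"
      using s(2)[of n] g[of "Suc n"] by fastforce
  qed
  then show "\<exists>\<gamma>\<in>{\<gamma>. closed_under H \<gamma>}. \<beta> < \<gamma>"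
    using s(1)[of 0] g[of 0] by (intro bexI[of _ g]) auto
next
  fix \<alpha> :: 'a
  assume *: "(\<exists>\<gamma>\<in>{\<gamma>. closed_under H \<gamma>}. \<gamma> < \<alpha>) \<and>
    (\<forall>\<beta><\<alpha>. \<exists>\<gamma>\<in>{\<gamma>. closed_under H \<gamma>}. \<beta> < \<gamma> \<and> \<gamma> < \<alpha>)"
  have "H \<sigma> \<subseteq> {..<\<alpha>}" if \<sigma>: "\<sigma> \<in> lists {..<\<alpha>}" for \<sigma>
  proof -
    obtain \<gamma> where "closed_under H \<gamma>" "\<gamma> < \<alpha>" "\<sigma> \<in> lists {..<\<gamma>}"
      using finite_list_below_member[of "{\<gamma>. closed_under H \<gamma> \<and> \<gamma> < \<alpha>}" \<sigma>] * \<sigma>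
      by (simp add: in_lists_conv_set) blast
    then show ?thesis
      unfolding closed_under_def by fastforce
  qed
  then show "\<alpha> \<in> {\<gamma>. closed_under H \<gamma>}"
    by (auto simp: closed_under_def)
qed

text \<open>Diamond guesses single sets, so an injection \<open>\<pi>\<close> codes a family indexed
  by \<open>nat\<close> into one set. A correct guess at a point closed under \<open>\<pi>\<close>
  decodes correctly below that point, and closure under a next-element map makes the point a limit
  of \<open>C\<close>.\<close>

lemma diamond_guesses_families:
  assumes om: "is_omega1 TYPE('a::wellorder)" and dia: "diamond TYPE('a)"
  obtains B :: "'a::wellorder \<Rightarrow> 'a \<Rightarrow> nat \<Rightarrow> bool" where
    "\<And>P C. (\<And>\<beta>. \<exists>\<gamma>\<in>C. \<beta> < \<gamma>) \<Longrightarrow>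
       \<exists>\<delta>. (\<exists>\<gamma>\<in>C. \<gamma> < \<delta>) \<and> (\<forall>\<beta><\<delta>. \<exists>\<gamma>\<in>C. \<beta> < \<gamma> \<and> \<gamma> < \<delta>) \<and>
           (\<forall>\<alpha><\<delta>. \<forall>k. B \<delta> \<alpha> k = P \<alpha> k)"
proof -
  have inf: "infinite (UNIV::'a set)"
    using om uncountable_infinite unfolding is_omega1_def by blast
  then have "(card_of ((UNIV::'a set) \<times> (UNIV::nat set)), card_of (UNIV::'a set)) \<in> ordLeq"
    by (rule ordIso_imp_ordLeq[OF card_of_Times_infinite_simps(1)])
      (use inf in \<open>simp_all flip: infinite_iff_card_of_nat\<close>)
  then obtain \<pi> :: "'a \<times> nat \<Rightarrow> 'a" where \<pi>: "inj \<pi>"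
    unfolding card_of_ordLeq[symmetric] by auto
  obtain A :: "'a \<Rightarrow> 'a set" where
    A: "\<And>X. stationary {\<alpha>. X \<inter> {..<\<alpha>} = A \<alpha>}"
    using dia unfolding diamond_def by auto
  show thesis
  proof (rule that[of "\<lambda>\<delta> \<alpha> k. \<pi> (\<alpha>, k) \<in> A \<delta>"])
    fix P :: "'a \<Rightarrow> nat \<Rightarrow> bool" and C :: "'a set"
    assume C: "\<And>\<beta>. \<exists>\<gamma>\<in>C. \<beta> < \<gamma>"
    then obtain nxt where nxt: "\<And>\<beta>. nxt \<beta> \<in> C \<and> \<beta> < nxt \<beta>"
      by metis
    define X where "X = {\<pi> (\<alpha>, k) |\<alpha> k. P \<alpha> k}"
    \<comment> \<open>The value at \<open>[]\<close> makes \<open>\<delta>\<close> nonzero, so that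
      some element of \<open>C\<close> lies below it.\<close>
    define H where "H \<sigma> = (case \<sigma> of [] \<Rightarrow> {undefined} | \<alpha> # _ \<Rightarrow> insert (nxt \<alpha>) (range (\<lambda>k. \<pi> (\<alpha>, k))))" for \<sigma>
    have "club {\<gamma>. closed_under H \<gamma>}"
      by (rule club_closed_under[OF om]) (auto simp: H_def split: list.split)
    then obtain \<delta> where \<delta>: "closed_under H \<delta>" "X \<inter> {..<\<delta>} = A \<delta>"
      using A[of X] unfolding stationary_def by blast
    have "H [] \<subseteq> {..<\<delta>}" and cl: "\<And>\<alpha>. \<alpha> < \<delta> \<Longrightarrow> H [\<alpha>] \<subseteq> {..<\<delta>}"
      using \<delta>(1) unfolding closed_under_def by auto
    then have "undefined < \<delta>" and lim: "\<And>\<alpha>. \<alpha> < \<delta> \<Longrightarrow> nxt \<alpha> < \<delta>"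
      and code: "\<And>\<alpha> k. \<alpha> < \<delta> \<Longrightarrow> \<pi> (\<alpha>, k) < \<delta>"
      by (fastforce simp: H_def)+
    moreover have "\<pi> (\<alpha>, k) \<in> A \<delta> \<longleftrightarrow> P \<alpha> k" if "\<alpha> < \<delta>" for \<alpha> k
    proof -
      have "\<pi> (\<alpha>, k) \<in> A \<delta> \<longleftrightarrow> \<pi> (\<alpha>, k) \<in> X"
        using code[OF that] \<delta>(2) by blast
      then show ?thesis
        using injD[OF \<pi>] unfolding X_def by blast
    qed
    ultimately show "\<exists>\<delta>. (\<exists>\<gamma>\<in>C. \<gamma> < \<delta>) \<and> (\<forall>\<beta><\<delta>. \<exists>\<gamma>\<in>C. \<beta> < \<gamma> \<and> \<gamma> < \<delta>) \<and>
           (\<forall>\<alpha><\<delta>. \<forall>k. (\<pi> (\<alpha>, k) \<in> A \<delta>) = P \<alpha> k)"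
      using nxt by (intro exI[of _ \<delta>]) blast
  qed
qed

lemma cofinal_omega_sequence:
  fixes \<delta> :: "'a::wellorder"
  assumes "countable {..<\<delta>}" "\<exists>\<gamma>\<in>S. \<gamma> < \<delta>" "\<forall>\<beta><\<delta>. \<exists>\<gamma>\<in>S. \<beta> < \<gamma> \<and> \<gamma> < \<delta>"
  obtains s :: "nat \<Rightarrow> 'a" where "strict_mono s" "\<And>n. s n \<in> S" "\<And>n. s n < \<delta>"
    "\<And>\<beta>. \<beta> < \<delta> \<Longrightarrow> \<exists>n. \<beta> < s n"
proof -
  obtain e :: "nat \<Rightarrow> 'a" where e: "{..<\<delta>} = range e"
    using assms(1,2) by (metis empty_iff lessThan_iff range_from_nat_into)
  have "\<exists>y. (y \<in> S \<and> y < \<delta>) \<and> x < y \<and> e n < y" if "x \<in> S \<and> x < \<delta>" for x n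
  proof -
    have "max x (e n) < \<delta>" using that e by auto
    then show ?thesis using assms(3) by (metis max_less_iff_conj)
  qed
  moreover have "\<exists>x. x \<in> S \<and> x < \<delta>"
    using assms(2) by blast
  ultimately obtain s where s: "\<And>n. s n \<in> S \<and> s n < \<delta> \<and> s n < s (Suc n) \<and> e n < s (Suc n)"
    using dependent_nat_choice[of "\<lambda>_ x. x \<in> S \<and> x < \<delta>" "\<lambda>n x y. x < y \<and> e n < y"] by metis
  show thesis
  proof (rule that[of s])
    show "strict_mono s" using s by (simp add: strict_mono_Suc_iff)
    show "\<exists>n. \<beta> < s n" if "\<beta> < \<delta>" for \<beta>
      using s e that by (metis lessThan_iff imageE)
  qed (use s in auto)
qed

section \<open>Interleaved ladders\<close>

definition interleaved :: "nat \<Rightarrow> (nat \<Rightarrow> 'a::linorder) \<Rightarrow> (nat \<Rightarrow> 'a) \<Rightarrow> bool" where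
  "interleaved l x y \<longleftrightarrow> (\<forall>j<l. x (2 * j) < y j \<and> y j < x (2 * j + 1))"

text \<open>For strictly increasing \<open>x\<close>, \<open>m\<close> is the number of ladder
  points below \<open>\<xi>\<close>.\<close>

definition first_above :: "(nat \<Rightarrow> 'a::linorder) \<Rightarrow> 'a \<Rightarrow> nat \<Rightarrow> bool" where
  "first_above x \<xi> m \<longleftrightarrow> \<xi> \<le> x m \<and> (\<forall>j<m. x j < \<xi>)"

lemma first_above_exists:
  assumes "\<xi> \<le> x j"
  obtains m where "first_above x \<xi> m" "m \<le> j"
proof
  show "first_above x \<xi> (LEAST j. \<xi> \<le> x j)"
    unfolding first_above_def using LeastI[of "\<lambda>j. \<xi> \<le> x j", OF assms] not_less_Least not_le by blast
  show "(LEAST j. \<xi> \<le> x j) \<le> j"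
    using assms by (rule Least_le)
qed

lemma first_above_unique:
  "first_above x \<xi> m \<Longrightarrow> first_above x \<xi> m' \<Longrightarrow> m = m'"
  unfolding first_above_def by (meson linorder_neqE_nat not_le)

text \<open>If \<open>m > 0\<close>, then \<open>y (m - 1)\<close> is below \<open>\<xi>\<close> and
  has at least \<open>2 * m - 1\<close> points of \<open>x\<close> below it, while
  \<open>y m\<close> is below \<open>x (2 * m + 1)\<close>. So passing from \<open>y\<close> to
  \<open>x\<close> doubles the count up to 1.\<close>

lemma first_above_interleaved_down:
  assumes "interleaved l x y" "strict_mono x" "first_above y \<xi> m" "m < l"
  obtains m' where "first_above x \<xi> m'" "m' \<le> 2 * m + 1" "2 * m \<le> m' + 1"
proof -
  have "\<xi> \<le> x (2 * m + 1)"
    using assms unfolding interleaved_def first_above_def by (meson le_less_trans less_imp_le)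
  then obtain m' where m': "first_above x \<xi> m'" "m' \<le> 2 * m + 1"
    by (rule first_above_exists)
  have "2 * m \<le> m' + 1"
  proof (rule ccontr)
    assume *: "\<not> ?thesis"
    then have "m' \<le> 2 * (m - 1)" "m - 1 < m" by auto
    then have "x m' \<le> x (2 * (m - 1))"
      using assms(2) by (simp add: strict_mono_less_eq)
    also have "\<dots> < y (m - 1)"
      using assms(1,4) unfolding interleaved_def by auto
    also have "\<dots> < \<xi>"
      using assms(3) \<open>m - 1 < m\<close> unfolding first_above_def by auto
    finally show False
      using m'(1) unfolding first_above_def by auto
  qed
  then show thesis using m' that by blast
qed

text \<open>What has to be shown is that \<open>y\<close> reaches \<open>\<xi>\<close> early enough:
  \<open>j\<close> is half of \<open>m'\<close> rounded up, so \<open>y j\<close> lies above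
  \<open>x m'\<close>. The bounds then follow from the doubling direction and uniqueness.\<close>

lemma first_above_interleaved_up:
  assumes "interleaved l x y" "strict_mono x" "first_above x \<xi> m'" "m' + 2 \<le> 2 * l"
  obtains m where "first_above y \<xi> m" "m' \<le> 2 * m + 1" "2 * m \<le> m' + 1"
proof -
  define j where "j = (m' + 1) div 2"
  have j: "m' \<le> 2 * j" "j < l" using assms(4) unfolding j_def by auto
  have "\<xi> \<le> x m'" using assms(3) unfolding first_above_def by auto
  also have "\<dots> \<le> x (2 * j)" using j assms(2) by (simp add: strict_mono_less_eq)
  also have "\<dots> < y j" using j assms(1) unfolding interleaved_def by auto
  finally have "\<xi> \<le> y j" by auto
  then obtain m where m: "first_above y \<xi> m" "m \<le> j"
    by (rule first_above_exists)
  then obtain m'' where "first_above x \<xi> m''" "m'' \<le> 2 * m + 1" "2 * m \<le> m'' + 1"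
    using first_above_interleaved_down[OF assms(1,2) m(1)] j by auto
  then show thesis
    using that[OF m(1)] first_above_unique[OF assms(3)] by metis
qed

text \<open>\<open>3 * 2 ^ e\<close> is the midpoint of \<open>2 ^ (e + 1)\<close> and \<open>2 ^ (e + 2)\<close>, so small errors leave \<open>e\<close> determined.\<close>

definition near_scale :: "nat \<Rightarrow> nat \<Rightarrow> nat \<Rightarrow> bool" where
  "near_scale k m e \<longleftrightarrow> m < 3 * 2 ^ e + 2 ^ k \<and> 3 * 2 ^ e < m + 2 ^ k"

text \<open>As \<open>k \<le> e\<close>, the window around \<open>3 * 2 ^ e\<close> lies strictly
  between \<open>2 ^ (e + 1)\<close> and \<open>2 ^ (e + 2)\<close>; these dyadic intervals are
  disjoint for distinct exponents.\<close>

lemma near_scale_unique_aux: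
  assumes "near_scale k m e" "near_scale k' m e'" "k \<le> e" "k' \<le> e'"
  shows "\<not> e < e'"
proof
  assume "e < e'"
  then have "(2::nat) ^ Suc e \<le> 2 ^ e'"
    by (intro power_increasing) auto
  moreover have "(2::nat) ^ k \<le> 2 ^ e" "(2::nat) ^ k' \<le> 2 ^ e'"
    using assms by (auto intro: power_increasing)
  ultimately show False
    using assms(1,2) unfolding near_scale_def by simp
qed

lemma near_scale_unique:
  assumes "near_scale k m e" "near_scale k' m e'" "k \<le> e" "k' \<le> e'"
  shows "e = e'"
  using near_scale_unique_aux assms by (meson linorder_neqE_nat)

text \<open>An error of at most \<open>2 ^ k - 1\<close> becomes at most
  \<open>2 ^ (k + 1) - 1\<close> after doubling with rounding error 1, and halving is milder. The
  bound on \<open>l\<close> ensures \<open>m < l\<close>, so the interleaving covers the relevant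
  ladder points.\<close>

lemma near_scale_step:
  assumes adj: "interleaved l x y \<or> interleaved l y x"
    and mono: "strict_mono x" "strict_mono y"
    and m: "first_above x \<xi> m" "near_scale k m e" "1 \<le> e" "3 * 2 ^ e + 2 ^ k \<le> l"
  obtains m' e' where "first_above y \<xi> m'" "near_scale (Suc k) m' e'" "e' = Suc e \<or> e = Suc e'"
proof -
  have "m < l" using m(2,4) unfolding near_scale_def by linarith
  obtain d where d: "e = Suc d" using m(3) by (cases e) auto
  from adj show thesis
  proof
    assume "interleaved l x y"
    then obtain m' where m': "first_above y \<xi> m'" "m \<le> 2 * m' + 1" "2 * m' \<le> m + 1"
      using first_above_interleaved_up[OF _ mono(1) m(1)] \<open>m < l\<close> by force
    then have "near_scale (Suc k) m' d"
      using m(2) unfolding near_scale_def d by simp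
    then show thesis using that m' d by blast
  next
    assume "interleaved l y x"
    then obtain m' where m': "first_above y \<xi> m'" "m' \<le> 2 * m + 1" "2 * m \<le> m' + 1"
      using first_above_interleaved_down[OF _ mono(2) m(1) \<open>m < l\<close>] by blast
    then have "near_scale (Suc k) m' (Suc e)"
      using m(2) unfolding near_scale_def by simp
    then show thesis using that m' by blast
  qed
qed

text \<open>The count at the root is exactly \<open>3 * 2 ^ L\<close>. Each edge moves the exponent
  by 1, so \<open>2 * k \<le> L\<close> keeps it at least \<open>k\<close>, and the bound on
  \<open>l\<close> keeps all counts in the interleaved range.\<close>

lemma near_scale_walk:
  fixes lad :: "'v \<Rightarrow> nat \<Rightarrow> 'a::linorder"
  assumes R: "\<And>u v. (u, v) \<in> R \<Longrightarrow> interleaved l (lad u) (lad v) \<or> interleaved l (lad v) (lad u)"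
    and mono: "\<And>v. strict_mono (lad v)"
    and walk: "(r, v) \<in> R ^^ k" and kL: "2 * k \<le> L" and l: "4 * 2 ^ (L + k) \<le> l"
  shows "\<exists>m e. first_above (lad v) (lad r (3 * 2 ^ L)) m \<and> near_scale k m e \<and> L \<le> e + k \<and> e \<le> L + k"
  using walk kL l
proof (induction k arbitrary: v)
  case 0
  have "first_above (lad r) (lad r (3 * 2 ^ L)) (3 * 2 ^ L)"
    using mono[of r] by (auto simp: first_above_def strict_mono_less)
  then show ?case using 0 by (auto simp: near_scale_def)
next
  case (Suc k)
  from Suc.prems(1) obtain u where u: "(r, u) \<in> R ^^ k" "(u, v) \<in> R"
    by auto
  have "(4::nat) * 2 ^ (L + k) \<le> 4 * 2 ^ (L + Suc k)" by simp
  then have "4 * 2 ^ (L + k) \<le> l" using Suc.prems(3) by linarith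
  then obtain m e where m: "first_above (lad u) (lad r (3 * 2 ^ L)) m" "near_scale k m e"
    "L \<le> e + k" "e \<le> L + k"
    using Suc.IH[OF u(1)] Suc.prems(2) by auto
  have "k \<le> e" using m(3) Suc.prems(2) by auto
  then have "(2::nat) ^ k \<le> 2 ^ e" "(2::nat) ^ e \<le> 2 ^ (L + k)"
    using m(4) by (auto intro!: power_increasing simp del: power_increasing_iff)
  then have "3 * 2 ^ e + 2 ^ k \<le> l" using \<open>4 * 2 ^ (L + k) \<le> l\<close> by linarith
  moreover have "1 \<le> e" using m(3) Suc.prems(2) by auto
  ultimately obtain m' e' where "first_above (lad v) (lad r (3 * 2 ^ L)) m'"
    "near_scale (Suc k) m' e'" "e' = Suc e \<or> e = Suc e'"
    using near_scale_step[OF R[OF u(2)] mono mono m(1,2)] by blast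
  then show ?case using m(3,4) by (intro exI[of _ m'] exI[of _ e']) auto
qed

text \<open>In each component fix a threshold on the ladder of a root. Along an edge the index at which the
  ladder passes the threshold is doubled or halved up to an error of 1, so on few vertices the
  rounded binary logarithm of this index changes by exactly 1, and its parity is a proper
  colouring.\<close>

lemma interleaved_locally_bipartite:
  fixes lad :: "'v \<Rightarrow> nat \<Rightarrow> 'a::linorder"
  assumes adj: "\<And>u v. (u, v) \<in> R \<Longrightarrow> interleaved l (lad u) (lad v) \<or> interleaved l (lad v) (lad u)"
    and mono: "\<And>v. strict_mono (lad v)"
    and R: "R \<subseteq> V \<times> V" "sym R" and V: "finite V" "card V \<le> K"
    and l: "2 ^ (3 * K\<^sup>2 + 4) \<le> l"
  obtains c :: "'v \<Rightarrow> nat" where "\<And>v. c v < 2" "\<And>u v. (u, v) \<in> R \<Longrightarrow> c u \<noteq> c v"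
proof -
  \<comment> \<open>\<open>Q\<close> bounds the number of edges, hence the length of some walk from
    the root. Exponents then stay at least \<open>Q + 2\<close>: one more edge may lower the
    exponent by 1 and raises the error index to at most \<open>Q + 1\<close>, and
    \<open>near_scale_unique\<close> still applies. The exponent required of \<open>l\<close> is
    \<open>L + Q + 2\<close>.\<close>
  define Q where "Q = K\<^sup>2"
  define L where "L = 2 * Q + 2"
  have fin: "finite R" using R(1) V(1) by (meson finite_SigmaI finite_subset)
  have "card R \<le> card (V \<times> V)" using R(1) V(1) by (intro card_mono) auto
  also have "\<dots> \<le> Q" using V(2) by (simp add: Q_def power2_eq_square mult_le_mono card_cartesian_product)
  finally have cardR: "card R \<le> Q" .
  \<comment> \<open>The choice depends only on the set of vertices that reach \<open>v\<close>, so
    it is constant on components.\<close>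
  define root where "root v = (SOME u. (u, v) \<in> R\<^sup>*)" for v
  have root: "(root v, v) \<in> R\<^sup>*" for v
    unfolding root_def by (rule someI[of _ v]) auto
  have root_eq: "root u = root v" if "(u, v) \<in> R" for u v
  proof -
    have "(v, u) \<in> R" using that R(2) by (auto dest: symD)
    then have "(w, u) \<in> R\<^sup>* \<longleftrightarrow> (w, v) \<in> R\<^sup>*" for w
      using that by (meson rtrancl.rtrancl_into_rtrancl)
    then show ?thesis unfolding root_def by simp
  qed
  define good where "good v e \<longleftrightarrow> (\<exists>k m. k \<le> Q \<and> first_above (lad v) (lad (root v) (3 * 2 ^ L)) m \<and>
      near_scale k m e \<and> L \<le> e + k \<and> e \<le> L + k)" for v e
  have "\<exists>e. good v e" for v
  proof -
    obtain k where k: "k \<le> card R" "(root v, v) \<in> R ^^ k"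
      using root[of v] rtrancl_finite_eq_relpow[OF fin] by auto
    have "(4::nat) * 2 ^ (L + k) = 2 ^ (L + k + 2)" by (simp add: power_add)
    also have "\<dots> \<le> 2 ^ (3 * K\<^sup>2 + 4)"
      using k(1) cardR by (intro power_increasing) (auto simp: L_def Q_def)
    finally have "4 * 2 ^ (L + k) \<le> l" using l by linarith
    moreover have "2 * k \<le> L" using k(1) cardR by (auto simp: L_def)
    ultimately show ?thesis
      using near_scale_walk[where R = R and l = l and lad = lad, OF adj mono k(2)] k(1) cardR unfolding good_def
      by (meson le_trans)
  qed
  then obtain e where e: "\<And>v. good v (e v)" by metis
  show thesis
  proof (rule that[of "\<lambda>v. e v mod 2"])
    fix u v assume uv: "(u, v) \<in> R"
    obtain k m where m: "k \<le> Q" "first_above (lad u) (lad (root u) (3 * 2 ^ L)) m"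
      "near_scale k m (e u)" "L \<le> e u + k" "e u \<le> L + k"
      using e[of u] unfolding good_def by blast
    obtain k' m' where m': "k' \<le> Q" "first_above (lad v) (lad (root v) (3 * 2 ^ L)) m'"
      "near_scale k' m' (e v)" "L \<le> e v + k'"
      using e[of v] unfolding good_def by blast
    have "(2::nat) ^ k \<le> 2 ^ e u"
      using m(1,4) by (intro power_increasing) (auto simp: L_def)
    then have "3 * 2 ^ e u + 2 ^ k \<le> (2::nat) ^ (e u + 2)" by (simp add: power_add)
    also have "\<dots> \<le> 2 ^ (3 * K\<^sup>2 + 4)"
      using m(1,5) by (intro power_increasing) (auto simp: L_def Q_def)
    finally have "3 * 2 ^ e u + 2 ^ k \<le> l" using l by linarith
    moreover have "1 \<le> e u" using m(1,4) by (auto simp: L_def)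
    ultimately obtain m'' e'' where m'': "first_above (lad v) (lad (root u) (3 * 2 ^ L)) m''"
      "near_scale (Suc k) m'' e''" "e'' = Suc (e u) \<or> e u = Suc e''"
      using near_scale_step[OF adj[OF uv] mono mono m(2,3)] by blast
    \<comment> \<open>Both counts at \<open>v\<close> refer to the same threshold, so the exponent
      carried over from \<open>u\<close> must be the one chosen at \<open>v\<close>, whatever walks
      were used.\<close>
    have "m'' = m'"
      using m''(1) m'(2) root_eq[OF uv] first_above_unique by metis
    then have "e'' = e v"
      using m''(2,3) m'(1,3,4) m(1,4) by (intro near_scale_unique[of "Suc k" m'' e'' k']) (auto simp: L_def)
    then have "e v = Suc (e u) \<or> e u = Suc (e v)" using m''(3) by simp
    then show "e u mod 2 \<noteq> e v mod 2" by (auto simp: mod_Suc split: if_splits)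
  qed auto
qed

section \<open>Trees of uncountable extensions\<close>

text \<open>This replaces closure under a countable elementary submodel: sets with parameters below
  \<open>\<gamma>\<close> are countable or uncountable according to how they look below
  \<open>\<gamma>\<close>.\<close>

definition reflects :: "('i \<Rightarrow> 'a::wellorder list \<Rightarrow> 'a set) \<Rightarrow> 'a \<Rightarrow> bool" where
  "reflects F \<gamma> \<longleftrightarrow> (\<exists>\<beta>. \<beta> < \<gamma>) \<and> (\<forall>i. \<forall>\<sigma>\<in>lists {..<\<gamma>}.
     (countable (F i \<sigma>) \<longrightarrow> F i \<sigma> \<subseteq> {..<\<gamma>}) \<and>
     (uncountable (F i \<sigma>) \<longrightarrow> (\<forall>\<beta><\<gamma>. \<exists>x\<in>F i \<sigma>. \<beta> < x \<and> x < \<gamma>)))"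

lemma uncountable_unbounded:
  fixes X :: "'a::wellorder set"
  assumes "is_omega1 TYPE('a)" "uncountable X"
  shows "\<exists>x\<in>X. \<beta> < x"
proof (rule ccontr)
  assume "\<not> ?thesis"
  then have "X \<subseteq> insert \<beta> {y. y < \<beta>}" by (auto simp: not_less le_less)
  moreover have "countable (insert \<beta> {y. y < \<beta>})"
    using assms(1) unfolding is_omega1_def by auto
  ultimately show False using assms(2) countable_subset by blast
qed

lemma reflects_unbounded:
  fixes F :: "'i::countable \<Rightarrow> 'a::wellorder list \<Rightarrow> 'a set"
  assumes om: "is_omega1 TYPE('a)"
  shows "\<exists>\<gamma>. reflects F \<gamma> \<and> \<beta> < \<gamma>"
proof -
  define w where "w i \<beta> \<sigma> = (SOME x. x \<in> F i \<sigma> \<and> \<beta> < x)" for i \<beta> \<sigma>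
  have w: "w i \<beta> \<sigma> \<in> F i \<sigma> \<and> \<beta> < w i \<beta> \<sigma>" if "uncountable (F i \<sigma>)" for i \<beta> \<sigma>
    unfolding w_def by (rule someI_ex) (use uncountable_unbounded[OF om that] in blast)
  \<comment> \<open>The head of the list serves as lower bound for a witness, the tail as the
    parameter.\<close>
  define H where "H \<sigma> = (\<Union>i. if countable (F i \<sigma>) then F i \<sigma> else {}) \<union>
    range (\<lambda>i. w i (hd \<sigma>) (tl \<sigma>))" for \<sigma>
  have "club {\<gamma>. closed_under H \<gamma>}"
    by (rule club_closed_under[OF om]) (auto simp: H_def)
  then obtain \<gamma> where \<gamma>: "closed_under H \<gamma>" "\<beta> < \<gamma>"
    unfolding club_def by blast
  have "reflects F \<gamma>"
    unfolding reflects_def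
  proof (intro conjI allI ballI impI)
    fix i \<sigma> assume "\<sigma> \<in> lists {..<\<gamma>}" "countable (F i \<sigma>)"
    moreover from this have "F i \<sigma> \<subseteq> H \<sigma>" unfolding H_def by auto
    ultimately show "F i \<sigma> \<subseteq> {..<\<gamma>}"
      using \<gamma>(1) unfolding closed_under_def by blast
  next
    fix i \<sigma> \<beta> assume "\<sigma> \<in> lists {..<\<gamma>}" "uncountable (F i \<sigma>)" "\<beta> < \<gamma>"
    moreover have "w i \<beta> \<sigma> \<in> H (\<beta> # \<sigma>)" unfolding H_def by auto
    ultimately have "w i \<beta> \<sigma> < \<gamma>"
      using \<gamma>(1) unfolding closed_under_def by (metis Cons_in_lists_iff lessThan_iff subsetD)
    then show "\<exists>x\<in>F i \<sigma>. \<beta> < x \<and> x < \<gamma>"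
      using w \<open>uncountable (F i \<sigma>)\<close> by blast
  qed (use \<gamma> in auto)
  then show ?thesis using \<gamma> by blast
qed

text \<open>Uncountability at level \<open>k\<close> iterates the quantifier "for uncountably many"
  over the next \<open>k\<close> entries, and once more over \<open>T\<close> of the resulting
  list.\<close>

primrec extensions :: "('a list \<Rightarrow> 'a set) \<Rightarrow> nat \<Rightarrow> 'a list \<Rightarrow> 'a set" where
  "extensions T 0 \<sigma> = T \<sigma>"
| "extensions T (Suc k) \<sigma> = {x. uncountable (extensions T k (\<sigma> @ [x]))}"

text \<open>A set with parameters below \<open>y i\<close> that has an element not below
  \<open>y i\<close> is uncountable by reflection. Starting from \<open>\<delta>\<close>, this is
  applied at \<open>y p\<close>, then at \<open>y (p - 1)\<close>, and so on down the
  branch.\<close>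

lemma uncountable_extensions_of_reflecting_branch:
  assumes y: "strict_mono y" "\<And>j. reflects (extensions T) (y j)"
    and d: "\<delta> \<in> T (map y [0..<p])" "\<And>j. y j < \<delta>"
  shows "uncountable (extensions T p [])"
proof -
  have pre: "map y [0..<i] \<in> lists {..<y i}" for i
    using y(1) by (auto simp: in_lists_conv_set strict_mono_less)
  have refl: "uncountable (extensions T k (map y [0..<i]))"
    if "x \<in> extensions T k (map y [0..<i])" "y i \<le> x" for x k i
    using y(2)[of i] that pre[of i] unfolding reflects_def by (meson lessThan_iff not_less subsetD)
  have "k \<le> p \<Longrightarrow> uncountable (extensions T k (map y [0..<p - k]))" for k
  proof (induction k)
    case 0
    show ?case using refl[of \<delta> 0 p] d by (auto intro: less_imp_le)
  next
    case (Suc k)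
    have "p - k = Suc (p - Suc k)" using Suc.prems by auto
    then have "map y [0..<p - k] = map y [0..<p - Suc k] @ [y (p - Suc k)]" by simp
    then have "y (p - Suc k) \<in> extensions T (Suc k) (map y [0..<p - Suc k])"
      using Suc by simp
    then show ?case by (rule refl) simp
  qed
  from this[of p] show ?thesis by simp
qed

text \<open>Each round adds two entries: reflection at \<open>y j\<close> gives one below
  \<open>y j\<close>, and reflection at \<open>y (Suc j)\<close> gives one between
  \<open>y j\<close> and \<open>y (Suc j)\<close>.\<close>

lemma interleaved_branch_exists:
  assumes y: "strict_mono y" "\<And>j. reflects (extensions T) (y j)"
    and T: "uncountable (extensions T (2 * l) [])"
  obtains \<sigma> where "length \<sigma> = 2 * l" "uncountable (T \<sigma>)" "\<sigma> \<in> lists {..<y l}"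
    "interleaved l ((!) \<sigma>) y"
proof -
  have "j \<le> l \<Longrightarrow> \<exists>\<sigma>. length \<sigma> = 2 * j \<and> uncountable (extensions T (2 * (l - j)) \<sigma>) \<and>
      \<sigma> \<in> lists {..<y j} \<and> interleaved j ((!) \<sigma>) y" for j
  proof (induction j)
    case 0
    then show ?case using T by (auto simp: interleaved_def)
  next
    case (Suc j)
    then obtain \<sigma> where \<sigma>: "length \<sigma> = 2 * j" "uncountable (extensions T (2 * (l - j)) \<sigma>)"
      "\<sigma> \<in> lists {..<y j}" "interleaved j ((!) \<sigma>) y" by auto
    define k where "k = 2 * (l - Suc j)"
    have k: "2 * (l - j) = Suc (Suc k)" using Suc.prems unfolding k_def by auto
    obtain x where x: "x \<in> extensions T (Suc (Suc k)) \<sigma>" "x < y j"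
      using y(2)[of j] \<sigma>(2,3) unfolding k reflects_def by meson
    have lt: "y j < y (Suc j)" using y(1) by (simp add: strict_mono_less)
    have "\<sigma> @ [x] \<in> lists {..<y (Suc j)}"
      using \<sigma>(3) x(2) lt by (fastforce simp: in_lists_conv_set)
    moreover have "uncountable (extensions T (Suc k) (\<sigma> @ [x]))" using x(1) by simp
    ultimately obtain z where z: "z \<in> extensions T (Suc k) (\<sigma> @ [x])" "y j < z" "z < y (Suc j)"
      using y(2)[of "Suc j"] lt unfolding reflects_def by meson
    let ?\<tau> = "\<sigma> @ [x, z]"
    have "interleaved (Suc j) ((!) ?\<tau>) y"
      using \<sigma>(1,4) x(2) z(2) by (auto simp: interleaved_def less_Suc_eq nth_append)
    moreover have "uncountable (extensions T k ?\<tau>)" using z(1) by simp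
    moreover have "?\<tau> \<in> lists {..<y (Suc j)}"
      using \<open>\<sigma> @ [x] \<in> lists {..<y (Suc j)}\<close> z(3) by auto
    ultimately show ?case
      using \<sigma>(1) unfolding k_def by (intro exI[of _ ?\<tau>]) auto
  qed
  from this[of l] show thesis using that by auto
qed

section \<open>Graphs given by regressive maps\<close>

text \<open>Each index contributes at most one smaller neighbour, and only finitely many indices
  contribute one up to \<open>\<gamma>\<close>; so below any \<open>\<gamma> < \<delta>\<close>
  there are finitely many.\<close>

lemma hajnal_mate_of_regressive_maps:
  fixes A :: "nat \<Rightarrow> 'a::wellorder \<Rightarrow> 'a \<Rightarrow> bool"
  assumes lt: "\<And>n \<alpha> \<delta>. A n \<alpha> \<delta> \<Longrightarrow> \<alpha> < \<delta>"
    and fn: "\<And>n \<alpha> \<alpha>' \<delta>. A n \<alpha> \<delta> \<Longrightarrow> A n \<alpha>' \<delta> \<Longrightarrow> \<alpha> = \<alpha>'"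
    and conv: "\<And>\<gamma> \<delta>. \<gamma> < \<delta> \<Longrightarrow> finite {n. \<exists>\<alpha>\<le>\<gamma>. A n \<alpha> \<delta>}"
  shows "hajnal_mate (\<lambda>x y. \<exists>n. A n x y \<or> A n y x)"
proof -
  have fin: "finite {\<alpha>. \<alpha> \<le> \<gamma> \<and> (\<exists>n. A n \<alpha> \<delta>)}" if "\<gamma> < \<delta>" for \<gamma> \<delta>
  proof -
    have "{\<alpha>. \<alpha> \<le> \<gamma> \<and> (\<exists>n. A n \<alpha> \<delta>)} \<subseteq> (\<lambda>n. THE \<alpha>. A n \<alpha> \<delta>) ` {n. \<exists>\<alpha>\<le>\<gamma>. A n \<alpha> \<delta>}"
    proof
      fix \<alpha> assume "\<alpha> \<in> {\<alpha>. \<alpha> \<le> \<gamma> \<and> (\<exists>n. A n \<alpha> \<delta>)}"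
      then obtain n where n: "\<alpha> \<le> \<gamma>" "A n \<alpha> \<delta>" by blast
      then have "(THE \<alpha>. A n \<alpha> \<delta>) = \<alpha>" using fn by blast
      then show "\<alpha> \<in> (\<lambda>n. THE \<alpha>. A n \<alpha> \<delta>) ` {n. \<exists>\<alpha>\<le>\<gamma>. A n \<alpha> \<delta>}"
        using n by (intro image_eqI[of _ _ n]) auto
    qed
    then show ?thesis using conv[OF that] by (meson finite_imageI finite_subset)
  qed
  have S: "{\<alpha>. \<alpha> < \<beta> \<and> (\<exists>n. A n \<alpha> \<beta> \<or> A n \<beta> \<alpha>)} = {\<alpha>. \<exists>n. A n \<alpha> \<beta>}" for \<beta>
    using lt less_asym by blast
  have "simple_graph (\<lambda>x y. \<exists>n. A n x y \<or> A n y x)"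
    unfolding simple_graph_def using lt by blast
  moreover have "finite {x \<in> {\<alpha>. \<exists>n. A n \<alpha> \<beta>}. x < \<alpha>}" if "\<alpha> \<in> {\<alpha>. \<exists>n. A n \<alpha> \<beta>}" for \<alpha> \<beta>
  proof -
    have "finite {\<alpha>'. \<alpha>' \<le> \<alpha> \<and> (\<exists>n. A n \<alpha>' \<beta>)}" using fin lt that by blast
    then show ?thesis by (rule rev_finite_subset) auto
  qed
  moreover have "\<exists>\<alpha>\<in>{\<alpha>. \<exists>n. A n \<alpha> \<beta>}. \<gamma> < \<alpha>" if "infinite {\<alpha>. \<exists>n. A n \<alpha> \<beta>}" "\<gamma> < \<beta>" for \<beta> \<gamma>
  proof (rule ccontr)
    assume "\<not> ?thesis"
    then have "{\<alpha>. \<exists>n. A n \<alpha> \<beta>} \<subseteq> {\<alpha>. \<alpha> \<le> \<gamma> \<and> (\<exists>n. A n \<alpha> \<beta>)}" by (auto simp: not_less)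
    then show False using that fin finite_subset by blast
  qed
  ultimately show ?thesis
    unfolding hajnal_mate_def Let_def S by blast
qed

text \<open>Each vertex has at most one smaller neighbour, so well-founded recursion can give it the
  opposite colour.\<close>

lemma regressive_map_two_colouring:
  fixes A :: "'a::wellorder \<Rightarrow> 'a \<Rightarrow> bool"
  assumes lt: "\<And>\<alpha> \<delta>. A \<alpha> \<delta> \<Longrightarrow> \<alpha> < \<delta>" and fn: "\<And>\<alpha> \<alpha>' \<delta>. A \<alpha> \<delta> \<Longrightarrow> A \<alpha>' \<delta> \<Longrightarrow> \<alpha> = \<alpha>'"
  obtains c :: "'a \<Rightarrow> nat" where "\<And>x. c x < 2" "\<And>x y. A x y \<Longrightarrow> c x \<noteq> c y"
proof -
  define G where "G g y = (if \<exists>x. A x y then 1 - g (THE x. A x y) else (0::nat))" for g y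
  define c where "c = wfrec {(x, y). x < y} G"
  have c: "c y = G (cut c {(x, y). x < y} y) y" for y
    unfolding c_def by (rule wfrec) (rule wf)
  have edge: "c y = 1 - c x" if "A x y" for x y
  proof -
    have "(THE x. A x y) = x" using that fn by blast
    then show ?thesis
      using that lt[OF that] by (subst c) (auto simp: G_def cut_apply)
  qed
  have bound: "c y < 2" for y
    by (subst c) (auto simp: G_def)
  show thesis
  proof (rule that[OF bound])
    show "c x \<noteq> c y" if "A x y" for x y
      using edge[OF that] by presburger
  qed
qed

lemma product_colouring:
  fixes c d :: "'v \<Rightarrow> nat"
  assumes "\<And>x. c x < a" "\<And>x. d x < b"
  obtains h :: "'v \<Rightarrow> nat" where "\<And>x. h x < a * b"
    "\<And>x y. c x \<noteq> c y \<or> d x \<noteq> d y \<Longrightarrow> h x \<noteq> h y"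
proof (rule that[of "\<lambda>x. c x * b + d x"])
  fix x
  have "c x * b + d x < Suc (c x) * b" using assms(2) by simp
  also have "\<dots> \<le> a * b" using assms(1)[of x] by (intro mult_le_mono) auto
  finally show "c x * b + d x < a * b" .
next
  fix x y assume *: "c x \<noteq> c y \<or> d x \<noteq> d y"
  have "(c z * b + d z) div b = c z" "(c z * b + d z) mod b = d z" for z
    using assms(2)[of z] by auto
  then show "c x * b + d x \<noteq> c y * b + d y" using * by metis
qed

lemma regressive_maps_colouring:
  fixes A :: "nat \<Rightarrow> 'a::wellorder \<Rightarrow> 'a \<Rightarrow> bool"
  assumes lt: "\<And>n \<alpha> \<delta>. A n \<alpha> \<delta> \<Longrightarrow> \<alpha> < \<delta>"
    and fn: "\<And>n \<alpha> \<alpha>' \<delta>. A n \<alpha> \<delta> \<Longrightarrow> A n \<alpha>' \<delta> \<Longrightarrow> \<alpha> = \<alpha>'"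
  shows "\<exists>c :: 'a \<Rightarrow> nat. (\<forall>x. c x < 2 ^ n) \<and> (\<forall>i<n. \<forall>x y. A i x y \<longrightarrow> c x \<noteq> c y)"
proof (induction n)
  case 0
  show ?case by (intro exI[of _ "\<lambda>_. 0"]) auto
next
  case (Suc n)
  then obtain c :: "'a \<Rightarrow> nat" where c: "\<And>x. c x < 2 ^ n" "\<And>i x y. i < n \<Longrightarrow> A i x y \<Longrightarrow> c x \<noteq> c y"
    by blast
  obtain d :: "'a \<Rightarrow> nat" where d: "\<And>x. d x < 2" "\<And>x y. A n x y \<Longrightarrow> d x \<noteq> d y"
    using regressive_map_two_colouring[of "A n"] lt fn by metis
  obtain h :: "'a \<Rightarrow> nat" where "\<And>x. h x < 2 ^ n * 2" "\<And>x y. c x \<noteq> c y \<or> d x \<noteq> d y \<Longrightarrow> h x \<noteq> h y"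
    using product_colouring[of c "2 ^ n" d 2] c(1) d(1) by blast
  then show ?case
    using c(2) d(2) by (intro exI[of _ h]) (auto simp: less_Suc_eq mult.commute)
qed

lemma chromatic_number_le:
  assumes "\<And>x. x \<in> V \<Longrightarrow> c x < n" "\<And>x y. x \<in> V \<Longrightarrow> y \<in> V \<Longrightarrow> E x y \<Longrightarrow> c x \<noteq> c y"
  shows "chromatic_number V E \<le> n"
  unfolding chromatic_number_def proper_colouring_def
  by (rule Least_le) (use assms in \<open>auto intro!: exI[of _ c]\<close>)

section \<open>The graph\<close>

theorem theoremB:
  fixes f :: "nat \<Rightarrow> nat"
  assumes omega1: "is_omega1 TYPE('a::wellorder)"
    and dia: "diamond TYPE('a)"
  shows "\<exists>E :: 'a \<Rightarrow> 'a \<Rightarrow> bool.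
           hajnal_mate E \<and>
           \<not> (\<exists>c :: 'a \<Rightarrow> nat. proper_colouring UNIV E c) \<and>
           (\<forall>k::nat. k \<ge> 3 \<longrightarrow>
              (\<forall>V' E'. subgraph V' E' UNIV E \<and> finite V' \<and> card V' < f k \<longrightarrow>
                 chromatic_number V' E' < k))"
proof -

  \<comment> \<open>Ladders and edges\<close>
  obtain B :: "'a \<Rightarrow> 'a \<Rightarrow> nat \<Rightarrow> bool" where
    B: "\<And>P C. (\<And>\<beta>. \<exists>\<gamma>\<in>C. \<beta> < \<gamma>) \<Longrightarrow>
       \<exists>\<delta>. (\<exists>\<gamma>\<in>C. \<gamma> < \<delta>) \<and> (\<forall>\<beta><\<delta>. \<exists>\<gamma>\<in>C. \<beta> < \<gamma> \<and> \<gamma> < \<delta>) \<and>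
           (\<forall>\<alpha><\<delta>. \<forall>k. B \<delta> \<alpha> k = P \<alpha> k)"
    using diamond_guesses_families[OF omega1 dia] by blast
  \<comment> \<open>Coordinate 0 of the guess stands for \<open>D\<close>, coordinate
    \<open>Suc n\<close> for colour class \<open>n\<close>.\<close>
  define ladder where "ladder \<delta> s \<longleftrightarrow> strict_mono s \<and> (\<forall>n::nat. s n < \<delta> \<and> B \<delta> (s n) 0) \<and>
    (\<forall>\<gamma><\<delta>. \<exists>n. \<gamma> < s n)" for \<delta> s
  have "\<exists>s::nat \<Rightarrow> 'a. \<forall>n. s n < s (Suc n)"
    using dependent_nat_choice[of "\<lambda>_ _. True" "\<lambda>_ x y. x < (y::'a)"] omega1_no_top[OF omega1] by auto
  then obtain s0 :: "nat \<Rightarrow> 'a" where "strict_mono s0"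
    by (auto simp: strict_mono_Suc_iff)
  \<comment> \<open>Vertices without a ladder get a default increasing sequence: they may still be
    lower endpoints of edges.\<close>
  then have "\<exists>s. strict_mono s \<and> ((\<exists>s'. ladder \<delta> s') \<longrightarrow> ladder \<delta> s)" for \<delta>
    unfolding ladder_def by blast
  then obtain lad where lad_mono: "\<And>\<delta>. strict_mono (lad \<delta>)"
    and lad: "\<And>\<delta> s. ladder \<delta> s \<Longrightarrow> ladder \<delta> (lad \<delta>)"
    by metis
  \<comment> \<open>The sum dominates the bound for every \<open>k\<close> up to
    \<open>2 ^ (n + 2)\<close>, whether or not \<open>f\<close> is monotone.\<close>
  define l :: "nat \<Rightarrow> nat" where "l n = (\<Sum>k\<le>2 ^ (n + 2). 2 ^ (3 * (f k)\<^sup>2 + 4))" for n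
  define cand where "cand n \<alpha> \<delta> \<longleftrightarrow> ladder \<delta> (lad \<delta>) \<and> lad \<delta> n < \<alpha> \<and> \<alpha> < \<delta> \<and>
    B \<delta> \<alpha> (Suc n) \<and> interleaved (l n) (lad \<alpha>) (lad \<delta>)" for n \<alpha> \<delta>
  define A where "A n \<alpha> \<delta> \<longleftrightarrow> cand n \<alpha> \<delta> \<and> \<alpha> = (SOME \<alpha>. cand n \<alpha> \<delta>)" for n \<alpha> \<delta>
  define E where "E x y \<longleftrightarrow> (\<exists>n. A n x y \<or> A n y x)" for x y
  have A_less: "A n \<alpha> \<delta> \<Longrightarrow> \<alpha> < \<delta>" for n \<alpha> \<delta>
    unfolding A_def cand_def by blast
  have A_fun: "A n \<alpha> \<delta> \<Longrightarrow> A n \<alpha>' \<delta> \<Longrightarrow> \<alpha> = \<alpha>'" for n \<alpha> \<alpha>' \<delta>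
    by (simp add: A_def)
  have A_conv: "finite {n. \<exists>\<alpha>\<le>\<gamma>. A n \<alpha> \<delta>}" if "\<gamma> < \<delta>" for \<gamma> \<delta>
  proof (cases "ladder \<delta> (lad \<delta>)")
    case True
    then obtain m where m: "\<gamma> < lad \<delta> m" using \<open>\<gamma> < \<delta>\<close> unfolding ladder_def by blast
    have "{n. \<exists>\<alpha>\<le>\<gamma>. A n \<alpha> \<delta>} \<subseteq> {..<m}"
    proof
      fix n assume "n \<in> {n. \<exists>\<alpha>\<le>\<gamma>. A n \<alpha> \<delta>}"
      then have "lad \<delta> n < lad \<delta> m" using m by (auto simp: A_def cand_def)
      then show "n \<in> {..<m}" using lad_mono by (simp add: strict_mono_less)
    qed
    then show ?thesis using finite_subset by blast
  qed (simp add: A_def cand_def)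

  have "hajnal_mate E"
    unfolding E_def[abs_def] using A_less A_fun A_conv by (rule hajnal_mate_of_regressive_maps)

  \<comment> \<open>Uncountable chromatic number\<close>
  moreover have "\<not> proper_colouring UNIV E c" for c :: "'a \<Rightarrow> nat"
  proof
    assume c: "proper_colouring UNIV E c"
    define T where "T n \<sigma> = {\<alpha>. c \<alpha> = n \<and> map (lad \<alpha>) [0..<length \<sigma>] = \<sigma>}" for n \<sigma>
    \<comment> \<open>All colours and levels are reflected at once, since the colour of
      \<open>\<delta>\<close> is known only after the guess.\<close>
    define D where "D = {\<gamma>. reflects (\<lambda>(n, k). extensions (T n) k) \<gamma>}"
    have "\<exists>\<gamma>\<in>D. \<beta> < \<gamma>" for \<beta>
      using reflects_unbounded[OF omega1] unfolding D_def by blast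
    from B[OF this, of "\<lambda>\<alpha> k. case k of 0 \<Rightarrow> \<alpha> \<in> D | Suc n \<Rightarrow> c \<alpha> = n"]
    obtain \<delta> where \<delta>: "\<exists>\<gamma>\<in>D. \<gamma> < \<delta>" "\<forall>\<beta><\<delta>. \<exists>\<gamma>\<in>D. \<beta> < \<gamma> \<and> \<gamma> < \<delta>"
      and guess: "\<And>\<alpha> k. \<alpha> < \<delta> \<Longrightarrow> B \<delta> \<alpha> k = (case k of 0 \<Rightarrow> \<alpha> \<in> D | Suc n \<Rightarrow> c \<alpha> = n)"
      by blast
    have "countable {..<\<delta>}"
      using omega1 unfolding is_omega1_def lessThan_def by auto
    then obtain s :: "nat \<Rightarrow> 'a" where "strict_mono s" "\<And>n. s n \<in> D" "\<And>n. s n < \<delta>"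
      "\<And>\<beta>. \<beta> < \<delta> \<Longrightarrow> \<exists>n. \<beta> < s n"
      using cofinal_omega_sequence[OF _ \<delta>] by blast
    then have "ladder \<delta> s"
      unfolding ladder_def using guess by auto
    then have lad\<delta>: "ladder \<delta> (lad \<delta>)" by (rule lad)
    define y where "y = lad \<delta>"
    have y: "strict_mono y" "\<And>j. y j < \<delta>" "\<And>j. B \<delta> (y j) 0"
      using lad\<delta> unfolding ladder_def y_def by auto
    have yD: "y j \<in> D" for j
      using guess[OF y(2), of j 0] y(3)[of j] by simp
    define n where "n = c \<delta>"
    have refl: "reflects (extensions (T n)) (y j)" for j
      using yD[of j] unfolding D_def reflects_def by force
    have "\<delta> \<in> T n (map y [0..<2 * l n])"
      unfolding T_def n_def y_def by simp
    then have "uncountable (extensions (T n) (2 * l n) [])"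
      using uncountable_extensions_of_reflecting_branch y refl by blast
    then obtain \<sigma> where \<sigma>: "length \<sigma> = 2 * l n" "uncountable (T n \<sigma>)" "\<sigma> \<in> lists {..<y (l n)}"
      "interleaved (l n) ((!) \<sigma>) y"
      using interleaved_branch_exists y(1) refl by blast
    \<comment> \<open>This places \<open>\<alpha>\<close> above \<open>y n\<close>, as
      \<open>cand\<close> demands, and \<open>\<sigma>\<close> below the reflecting point
      \<open>y (Suc q)\<close>.\<close>
    define q where "q = max n (l n)"
    have "y (l n) < y (Suc q)" "y q < y (Suc q)" "y n \<le> y q"
      using y(1) by (auto simp: q_def strict_mono_less strict_mono_less_eq)
    then have "\<sigma> \<in> lists {..<y (Suc q)}"
      using \<sigma>(3) by (fastforce simp: in_lists_conv_set)
    moreover have "uncountable (extensions (T n) 0 \<sigma>)" using \<sigma>(2) by simp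
    ultimately obtain \<alpha> where \<alpha>: "\<alpha> \<in> extensions (T n) 0 \<sigma>" "y q < \<alpha>" "\<alpha> < y (Suc q)"
      using refl[of "Suc q"] \<open>y q < y (Suc q)\<close> unfolding reflects_def by meson
    have "\<alpha> < \<delta>" using \<alpha>(3) y(2) less_trans by blast
    have c\<alpha>: "c \<alpha> = n" and lad\<alpha>: "map (lad \<alpha>) [0..<2 * l n] = \<sigma>"
      using \<alpha>(1) \<sigma>(1) unfolding T_def by auto
    have "\<sigma> ! i = lad \<alpha> i" if "i < 2 * l n" for i
      using that by (simp flip: lad\<alpha>)
    then have "interleaved (l n) (lad \<alpha>) y"
      using \<sigma>(4) unfolding interleaved_def by simp
    then have "cand n \<alpha> \<delta>"
      using lad\<delta> \<alpha>(2) \<open>\<alpha> < \<delta>\<close> \<open>y n \<le> y q\<close> c\<alpha> guess unfolding cand_def y_def by auto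
    \<comment> \<open>The chosen neighbour may differ from \<open>\<alpha>\<close>, but the correct
      guess gives every candidate colour \<open>n\<close>.\<close>
    then obtain \<alpha>' where \<alpha>': "cand n \<alpha>' \<delta>" "A n \<alpha>' \<delta>"
      unfolding A_def by (metis someI)
    then have "E \<alpha>' \<delta>" unfolding E_def by blast
    moreover have "c \<alpha>' = c \<delta>"
      using \<alpha>'(1) guess[of \<alpha>' "Suc n"] unfolding cand_def n_def by simp
    ultimately show False
      using c unfolding proper_colouring_def by blast
  qed

  \<comment> \<open>Subgraphs with few vertices\<close>
  moreover have "chromatic_number V E' < k"
    if k: "3 \<le> k" and V: "subgraph V E' UNIV E" "finite V" "card V < f k" for k V E'
  proof -
    \<comment> \<open>With \<open>n' = Suc n\<close>, the \<open>2 ^ n\<close> colours for indices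
      below \<open>n\<close> and the 2 for the others multiply to at most \<open>k - 1\<close>. The
      upper bound gives \<open>k \<le> 2 ^ (n + 2)\<close>, so \<open>k\<close> occurs in the sum
      \<open>l i\<close> for all \<open>i \<ge> n\<close>.\<close>
    obtain n' where n': "2 ^ n' \<le> k - 1" "k - 1 < 2 ^ (n' + 1)"
      using ex_power_ivl1[of 2 "k - 1"] k by fastforce
    have "n' \<noteq> 0" using n'(2) k by (intro notI) simp
    then obtain n where n: "n' = Suc n" using not0_implies_Suc by blast
    have l: "2 ^ (3 * (f k)\<^sup>2 + 4) \<le> l i" if "n \<le> i" for i
    proof -
      have "k \<le> 2 ^ (n + 2)" using n'(2) n by simp
      also have "\<dots> \<le> 2 ^ (i + 2)" using that by (intro power_increasing) auto
      finally show ?thesis unfolding l_def by (intro member_le_sum) auto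
    qed
    define R where "R = {(u, v). u \<in> V \<and> v \<in> V \<and> (\<exists>i\<ge>n. A i u v \<or> A i v u)}"
    let ?m = "2 ^ (3 * (f k)\<^sup>2 + 4)"
    have A_int: "interleaved ?m (lad u) (lad v)" if "A i u v" "n \<le> i" for i u v
      using that l[of i] unfolding A_def cand_def interleaved_def by auto
    have adj: "interleaved ?m (lad u) (lad v) \<or> interleaved ?m (lad v) (lad u)" if "(u, v) \<in> R" for u v
      using that A_int unfolding R_def by blast
    have R: "R \<subseteq> V \<times> V" "sym R" unfolding R_def sym_def by blast+
    obtain d :: "'a \<Rightarrow> nat" where d: "\<And>v. d v < 2" "\<And>u v. (u, v) \<in> R \<Longrightarrow> d u \<noteq> d v"
      using interleaved_locally_bipartite[where lad = lad, OF adj lad_mono R V(2) less_imp_le[OF V(3)] order_refl]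
      by blast
    have "\<exists>c :: 'a \<Rightarrow> nat. (\<forall>x. c x < 2 ^ n) \<and> (\<forall>i<n. \<forall>x y. A i x y \<longrightarrow> c x \<noteq> c y)"
      using A_less A_fun by (rule regressive_maps_colouring)
    then obtain c :: "'a \<Rightarrow> nat" where c: "\<And>x. c x < 2 ^ n" "\<And>i x y. i < n \<Longrightarrow> A i x y \<Longrightarrow> c x \<noteq> c y"
      by blast
    obtain h :: "'a \<Rightarrow> nat" where h: "\<And>x. h x < 2 ^ n * 2"
      "\<And>x y. c x \<noteq> c y \<or> d x \<noteq> d y \<Longrightarrow> h x \<noteq> h y"
      using product_colouring[of c "2 ^ n" d 2] c(1) d(1) by blast
    have "chromatic_number V E' \<le> 2 ^ n * 2"
    proof (rule chromatic_number_le[of V h])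
      fix x y assume xy: "x \<in> V" "y \<in> V" "E' x y"
      then obtain i where "A i x y \<or> A i y x"
        using V(1) unfolding subgraph_def E_def by blast
      then have "c x \<noteq> c y \<or> d x \<noteq> d y"
        using c(2)[of i x y] c(2)[of i y x] d(2)[of x y] xy unfolding R_def by (cases "i < n") (auto simp: not_less)
      then show "h x \<noteq> h y" by (rule h(2))
    qed (rule h(1))
    then show ?thesis using n' n k by simp
  qed

  ultimately show ?thesis by blast
qed

end
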